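(* Let $\{B_n(x)\}_{n=0}^\infty$ be a sequence in $\mathbb{R}[x]$ with $\deg(B_n(x))=n$ for every $n\in\mathbb{N}_0$ (and $B_0(x)\not\equiv 0$), let $\{a_n\}_{n=0}^\infty$ be a sequence of real numbers, and let $\{Q_k(x)\}_{k=0}^\infty$ be a sequence in $\mathbb{R}[x]$ such that the linear operator $T=\sum_{k=0}^\infty Q_k(x)D^k:\mathbb{R}[x]\to\mathbb{R}[x]$ satisfies $$T[B_n(x)]=\left(\sum_{k=0}^\infty Q_k(x)D^k\right)B_n(x)=a_nB_n(x)\quad\text{for every } n\in\mathbb{N}_0 .$$ Then each of the following statements holds. (1) If $T$ is of finite order, then $\{a_n\}_{n=0}^\infty$ can be interpolated by a polynomial. (2) If $\{a_n\}_{n=0}^\infty$ cannot be interpolated by a polynomial, then $T$ is of infinite order. (3) If $\{a_n\}_{n=0}^\infty$ is a non-constant sequence with a bounded subsequence, then $T$ is of infinite order. (4) If $\{a_n\}_{n=0}^\infty$ is either a non-constant, non-negative, decreasing sequence or a non-constant, non-positive, increasing sequence, then $T$ is of infinite order. (5) If $\{a_n\}_{n=0}^\infty$ is a non-constant alternating sequence, then $T$ is of infinite order.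
   Context: $\mathbb{N}_0=\{0,1,2,\dots\}$ and $D=\frac{d}{dx}$. The operator $\sum_{k=0}^\infty Q_k(x)D^k$ acts on $p\in\mathbb{R}[x]$ by $p\mapsto\sum_{k=0}^{\infty}Q_k(x)p^{(k)}(x)$, a finite sum since $p^{(k)}=0$ for $k>\deg p$. $T$ is of finite order (of order $n$) if $Q_n(x)\not\equiv0$ and $Q_k(x)\equiv 0$ for all $k>n$; $T$ is of infinite order if $Q_k(x)\not\equiv 0$ for infinitely many $k\in\mathbb{N}_0$. A sequence of real numbers $\{a_n\}_{n=0}^\infty$ is (can be) interpolated by a polynomial if there is a polynomial $p(x)$ with $a_n=p(n)$ for every $n\in\mathbb{N}_0$; otherwise it cannot be interpolated by a polynomial. "Subsequence" means an infinite subsequence. "Decreasing" and "increasing" are understood in the weak sense. "Alternating" means alternating in sign in the weak sense: either $(-1)^na_n\ge 0$ for all $n$, or $(-1)^{n}a_n\le 0$ for all $n$. *)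

theory Defs
  imports Complex_Main "HOL-Analysis.Analysis" "HOL-Computational_Algebra.Polynomial"
begin

text \<open>
  The operator \<open>\<Sum>k. Q\<^sub>k D\<^sup>k\<close>. Truncating the series at \<^term>\<open>degree p\<close> drops only
  zero terms, see the lemma below.
\<close>

definition diff_op :: "(nat \<Rightarrow> real poly) \<Rightarrow> real poly \<Rightarrow> real poly" where
  "diff_op Q p = (\<Sum>k\<le>degree p. Q k * (pderiv ^^ k) p)"

lemma higher_pderiv_eq_0:
  fixes p :: "real poly"
  assumes "degree p < k"
  shows "(pderiv ^^ k) p = 0"
proof -
  have "degree ((pderiv ^^ degree p) p) = 0"
    by (simp add: degree_higher_pderiv)
  then have "(pderiv ^^ Suc (degree p)) p = 0"
    by (simp add: pderiv_eq_0_iff)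
  moreover have "(pderiv ^^ j) (0 :: real poly) = 0" for j
    by (induction j) simp_all
  moreover have "k = (k - Suc (degree p)) + Suc (degree p)"
    using assms by simp
  ultimately show ?thesis
    by (metis funpow_add o_apply)
qed

lemma diff_op_eq_sum:
  assumes "degree p \<le> N"
  shows "diff_op Q p = (\<Sum>k\<le>N. Q k * (pderiv ^^ k) p)"
  unfolding diff_op_def
  by (rule sum.mono_neutral_left) (use assms in \<open>auto simp: higher_pderiv_eq_0\<close>)

text \<open>
  The coefficient polynomials \<open>Q\<^sub>k\<close> are uniquely determined by the operator, so its order is
  stated in terms of them. The zero operator has neither finite nor infinite order.
\<close>

definition has_order :: "(nat \<Rightarrow> real poly) \<Rightarrow> nat \<Rightarrow> bool" where
  "has_order Q n \<longleftrightarrow> Q n \<noteq> 0 \<and> (\<forall>k>n. Q k = 0)"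

definition finite_order :: "(nat \<Rightarrow> real poly) \<Rightarrow> bool" where
  "finite_order Q \<longleftrightarrow> (\<exists>n. has_order Q n)"

definition infinite_order :: "(nat \<Rightarrow> real poly) \<Rightarrow> bool" where
  "infinite_order Q \<longleftrightarrow> infinite {k. Q k \<noteq> 0}"

definition poly_interpolated :: "(nat \<Rightarrow> real) \<Rightarrow> bool" where
  "poly_interpolated a \<longleftrightarrow> (\<exists>p :: real poly. \<forall>n. a n = poly p (real n))"

definition has_bounded_subseq :: "(nat \<Rightarrow> real) \<Rightarrow> bool" where
  "has_bounded_subseq a \<longleftrightarrow> (\<exists>r :: nat \<Rightarrow> nat. strict_mono r \<and> Bseq (a \<circ> r))"

definition alternating :: "(nat \<Rightarrow> real) \<Rightarrow> bool" where
  "alternating a \<longleftrightarrow> (\<forall>n. (-1) ^ n * a n \<ge> 0) \<or> (\<forall>n. (-1) ^ n * a n \<le> 0)"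

end

theory Submission
  imports Defs
begin

text \<open>
  Write \<open>q\<^sub>k\<close> for the coefficient of \<open>x\<^sup>k\<close> in \<open>Q\<^sub>k\<close>. The eigenvalue equations force
  \<open>deg Q\<^sub>k \<le> k\<close>: by induction every term but the last of \<open>T B\<^sub>k\<close> has degree at most \<open>k\<close>, so does
  the multiple \<open>a\<^sub>k B\<^sub>k\<close>, and the last term is \<open>Q\<^sub>k\<close> times a nonzero constant
  (\<open>degree_coefficient_le\<close>). Therefore each \<open>Q\<^sub>k D\<^sup>k\<close> preserves the degree bound \<open>n\<close> and acts on
  \<open>x\<^sup>n\<close>-coefficients as multiplication by \<open>q\<^sub>k n(n-1)\<cdots>(n-k+1)\<close>
  (\<open>coeff_mult_higher_pderiv\<close>). Comparing leading coefficients in the eigenvalue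
  equation for \<open>B\<^sub>n\<close> gives

  \<open>a\<^sub>n = \<Sum>k. q\<^sub>k n(n-1)\<cdots>(n-k+1)\<close>,

  which is a polynomial in \<open>n\<close> as soon as only finitely many \<open>Q\<^sub>k\<close> are nonzero
  (\<open>poly_interpolated_if_not_infinite_order\<close>).

  The other claims only need the growth of a non-constant real polynomial: it tends to
  infinity in absolute value, which excludes bounded subsequences and, with them, the monotone
  sequences bounded by \<open>0\<close>; and it eventually has the strict sign of its leading coefficient, which
  excludes alternation.
\<close>

section \<open>Degrees of the coefficient polynomials\<close>

lemma coeff_mult_degree_bounds:
  fixes p q :: "'a :: comm_semiring_0 poly"
  assumes "degree p \<le> k" and "degree q \<le> m"
  shows "coeff (p * q) (k + m) = coeff p k * coeff q m"
proof -
  have "coeff (p * q) (k + m) = (\<Sum>i\<le>k + m. coeff p i * coeff q (k + m - i))"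
    by (rule coeff_mult)
  also have "\<dots> = (\<Sum>i\<in>{k}. coeff p i * coeff q (k + m - i))"
  proof (rule sum.mono_neutral_right)
    show "\<forall>i\<in>{..k + m} - {k}. coeff p i * coeff q (k + m - i) = 0"
    proof
      fix i assume "i \<in> {..k + m} - {k}"
      then have "degree p < i \<or> degree q < k + m - i"
        using assms by auto
      then show "coeff p i * coeff q (k + m - i) = 0"
        by (auto simp: coeff_eq_0)
    qed
  qed auto
  finally show ?thesis by simp
qed

text \<open>
  The degree bound on \<open>Q\<^sub>k\<close> is obtained by solving the eigenvalue equation for \<open>B\<^sub>k\<close> for its last
  term: \<open>D\<^sup>k B\<^sub>k\<close> is a nonzero constant, so \<open>Q\<^sub>k D\<^sup>k B\<^sub>k\<close> has the same degree as \<open>Q\<^sub>k\<close>.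
\<close>

lemma degree_coefficient_le:
  assumes deg_B: "\<And>n. degree (B n) = n"
    and "B 0 \<noteq> 0"
    and eigen: "\<And>n. diff_op Q (B n) = smult (a n) (B n)"
  shows "degree (Q k) \<le> k"
proof (induction k rule: less_induct)
  case (less k)
  let ?D = "\<lambda>j. (pderiv ^^ j) (B k)"
  have "coeff (B k) k \<noteq> 0"
    using deg_B[of k] \<open>B 0 \<noteq> 0\<close> by (cases "k = 0") (metis leading_coeff_0_iff degree_0)+
  then have "coeff (?D k) 0 \<noteq> 0"
    by (simp add: coeff_higher_pderiv pochhammer_eq_0_iff)
  then have "?D k \<noteq> 0" by auto
  have "degree (Q j * ?D j) \<le> k" if "j < k" for j
    using degree_mult_le[of "Q j" "?D j"] less.IH[OF that] that
    by (simp add: degree_higher_pderiv deg_B)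
  then have lower: "degree (\<Sum>j<k. Q j * ?D j) \<le> k"
    by (intro degree_sum_le) auto
  have "diff_op Q (B k) = (\<Sum>j<k. Q j * ?D j) + Q k * ?D k"
    by (simp add: diff_op_def deg_B lessThan_Suc_atMost[symmetric])
  then have "Q k * ?D k = smult (a k) (B k) - (\<Sum>j<k. Q j * ?D j)"
    by (simp add: eigen algebra_simps)
  moreover have "degree (smult (a k) (B k)) \<le> k"
    using degree_smult_le[of "a k" "B k"] by (simp add: deg_B)
  ultimately have "degree (Q k * ?D k) \<le> k"
    using lower by (simp add: degree_diff_le)
  then show ?case
    using \<open>?D k \<noteq> 0\<close> by (cases "Q k = 0") (simp_all add: degree_mult_eq)
qed

section \<open>The eigenvalues as values of a polynomial\<close>

text \<open>
  Its value at \<open>n\<close> is the factor in \<open>D\<^sup>k x\<^sup>n = n(n-1)\<cdots>(n-k+1) x\<^bsup>n-k\<^esup>\<close>, here as a polynomial in \<open>n\<close>.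
\<close>

definition falling_factorial_poly :: "nat \<Rightarrow> real poly" where
  "falling_factorial_poly k = (\<Prod>i<k. [:- real i, 1:])"

lemma poly_falling_factorial_poly:
  "poly (falling_factorial_poly k) x = pochhammer (x - real k + 1) k"
  using gbinomial_prod_rev[of x k] gbinomial_pochhammer'[of x k]
  by (simp add: falling_factorial_poly_def poly_prod atLeast0LessThan)

text \<open>
  For \<open>k > n\<close> both sides vanish, the right one because the falling factorial has the factor \<open>n - n\<close>.
  Because the formula covers this case too, \<open>a\<^sub>n\<close> is a sum over a range of \<open>k\<close> independent of \<open>n\<close>.
\<close>

lemma coeff_mult_higher_pderiv:
  fixes p q :: "real poly"
  assumes "degree q \<le> k" and "degree p \<le> n"
  shows "coeff (q * (pderiv ^^ k) p) n =
    coeff q k * poly (falling_factorial_poly k) (real n) * coeff p n"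
proof (cases "k \<le> n")
  case True
  have "coeff (q * (pderiv ^^ k) p) (k + (n - k)) = coeff q k * coeff ((pderiv ^^ k) p) (n - k)"
    using assms by (intro coeff_mult_degree_bounds) (simp_all add: degree_higher_pderiv)
  then show ?thesis
    using True
    by (simp add: coeff_higher_pderiv poly_falling_factorial_poly of_nat_diff algebra_simps)
next
  case False
  then have "poly (falling_factorial_poly k) (real n) = 0"
    by (auto simp: falling_factorial_poly_def poly_prod)
  with False show ?thesis
    using assms by (simp add: higher_pderiv_eq_0)
qed

lemma poly_interpolated_if_not_infinite_order:
  assumes deg_B: "\<And>n. degree (B n) = n"
    and "B 0 \<noteq> 0"
    and eigen: "\<And>n. diff_op Q (B n) = smult (a n) (B n)"
    and fin: "\<not> infinite_order Q"
  shows "poly_interpolated a"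
proof -
  obtain N where N: "\<And>k. N < k \<Longrightarrow> Q k = 0"
    using fin by (auto simp: infinite_order_def finite_nat_set_iff_bounded_le) (meson leD)
  define p where "p = (\<Sum>k\<le>N. smult (coeff (Q k) k) (falling_factorial_poly k))"
  have "a n = poly p (real n)" for n
  proof -
    have lead: "coeff (B n) n \<noteq> 0"
      using deg_B[of n] \<open>B 0 \<noteq> 0\<close> by (cases "n = 0") (metis leading_coeff_0_iff degree_0)+
    have "smult (a n) (B n) = (\<Sum>k\<le>max N n. Q k * (pderiv ^^ k) (B n))"
      using diff_op_eq_sum[of "B n" "max N n" Q] by (simp add: deg_B eigen)
    also have "\<dots> = (\<Sum>k\<le>N. Q k * (pderiv ^^ k) (B n))"
      by (rule sum.mono_neutral_right) (auto simp: N)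
    finally have "a n * coeff (B n) n = (\<Sum>k\<le>N. coeff (Q k * (pderiv ^^ k) (B n)) n)"
      by (metis coeff_smult coeff_sum)
    also have "\<dots> = poly p (real n) * coeff (B n) n"
      using degree_coefficient_le[of B Q a] assms
      by (simp add: p_def coeff_mult_higher_pderiv poly_sum sum_distrib_right)
    finally show ?thesis using lead by simp
  qed
  then show ?thesis by (auto simp: poly_interpolated_def)
qed

section \<open>Growth of polynomially interpolated sequences\<close>

lemma poly_interpolated_bounded_subseq_constant:
  assumes "poly_interpolated a" and "has_bounded_subseq a"
  shows "a constant_on UNIV"
proof -
  obtain p :: "real poly" where p: "\<And>n. a n = poly p (real n)"
    using assms(1) by (auto simp: poly_interpolated_def)
  obtain r :: "nat \<Rightarrow> nat" where r: "strict_mono r" "Bseq (a \<circ> r)"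
    using assms(2) by (auto simp: has_bounded_subseq_def)
  have "degree p = 0"
  proof (rule ccontr)
    assume "degree p \<noteq> 0"
    then have "filterlim (poly p) at_infinity at_infinity"
      by (simp add: filterlim_poly_at_infinity)
    moreover have "filterlim (\<lambda>n. real (r n)) at_infinity sequentially"
      using filterlim_compose[OF filterlim_real_sequentially filterlim_subseq[OF r(1)]]
      by (rule filterlim_at_top_imp_at_infinity)
    ultimately have "filterlim (\<lambda>n. poly p (real (r n))) at_infinity sequentially"
      by (rule filterlim_compose)
    moreover have "(\<lambda>n. poly p (real (r n))) = a \<circ> r"
      by (simp add: p fun_eq_iff)
    ultimately have "filterlim (a \<circ> r) at_infinity sequentially"
      by simp
    then have "filterlim (\<lambda>n. norm ((a \<circ> r) n)) at_top sequentially"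
      by (rule filterlim_at_infinity_imp_norm_at_top)
    moreover obtain K where "0 < K" "\<And>n. norm ((a \<circ> r) n) \<le> K"
      using BseqE[OF r(2)] by blast
    ultimately have "eventually (\<lambda>n. K < norm ((a \<circ> r) n)) sequentially"
      unfolding filterlim_at_top_dense by blast
    then show False
      using \<open>\<And>n. norm ((a \<circ> r) n) \<le> K\<close> by (simp add: leD)
  qed
  then show ?thesis
    by (auto simp: constant_on_def p elim!: degree_eq_zeroE)
qed

text \<open>
  Multiplying \<open>p\<close> by its leading coefficient makes the leading coefficient a positive square, so
  both signs reduce to the case of a positive leading coefficient.
\<close>

lemma poly_eventually_sign_lead_coeff:
  fixes p :: "real poly"
  assumes "p \<noteq> 0"
  shows "\<exists>x0. \<forall>x\<ge>x0. lead_coeff p * poly p x > 0"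
proof -
  have "lead_coeff (smult (lead_coeff p) p) > 0"
    unfolding lead_coeff_smult
    using assms not_real_square_gt_zero[of "lead_coeff p"] leading_coeff_0_iff by blast
  from poly_pinfty_gt_lc[OF this] this show ?thesis
    by (metis order_less_le_trans poly_smult)
qed

text \<open>
  Two consecutive terms of an alternating sequence have a nonpositive product, whereas far
  out the values of a nonzero polynomial all have the same strict sign. So only the zero
  sequence is left.
\<close>

lemma poly_interpolated_alternating_constant:
  assumes "poly_interpolated a" and "alternating a"
  shows "a constant_on UNIV"
proof -
  obtain p :: "real poly" where p: "\<And>n. a n = poly p (real n)"
    using assms(1) by (auto simp: poly_interpolated_def)
  have "p = 0"
  proof (rule ccontr)
    assume "p \<noteq> 0"
    then obtain x0 where x0: "\<And>x. x \<ge> x0 \<Longrightarrow> lead_coeff p * poly p x > 0"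
      using poly_eventually_sign_lead_coeff by blast
    obtain m where m: "x0 \<le> real m"
      using real_arch_simple by blast
    have "lead_coeff p * a (2 * m) > 0" "lead_coeff p * a (2 * m + 1) > 0"
      unfolding p by (rule x0, use m in simp)+
    moreover have "(a (2 * m) \<ge> 0 \<and> a (2 * m + 1) \<le> 0) \<or> (a (2 * m) \<le> 0 \<and> a (2 * m + 1) \<ge> 0)"
      using assms(2) unfolding alternating_def
    proof
      assume "\<forall>n. (- 1) ^ n * a n \<ge> 0"
      from this[rule_format, of "2 * m"] this[rule_format, of "2 * m + 1"] show ?thesis by simp
    next
      assume "\<forall>n. (- 1) ^ n * a n \<le> 0"
      from this[rule_format, of "2 * m"] this[rule_format, of "2 * m + 1"] show ?thesis by simp
    qed
    ultimately show False
      by (auto simp: zero_less_mult_iff)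
  qed
  then show ?thesis
    by (simp add: constant_on_def p)
qed

lemma has_bounded_subseq_if_Bseq:
  assumes "Bseq a"
  shows "has_bounded_subseq a"
  unfolding has_bounded_subseq_def
  by (rule exI[of _ "\<lambda>n. n"]) (use assms in \<open>simp add: strict_mono_def comp_def\<close>)

lemma monotone_towards_zero_Bseq:
  fixes a :: "nat \<Rightarrow> real"
  assumes "((\<forall>n. a n \<ge> 0) \<and> decseq a) \<or> ((\<forall>n. a n \<le> 0) \<and> incseq a)"
  shows "Bseq a"
proof (rule BseqI')
  show "norm (a n) \<le> \<bar>a 0\<bar>" for n
    using assms decseqD[of a 0 n] incseqD[of a 0 n] by fastforce
qed

section \<open>Criteria for infinite order\<close>

theorem corollary9:
  fixes B Q :: "nat \<Rightarrow> real poly" and a :: "nat \<Rightarrow> real"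
  assumes "\<And>n. degree (B n) = n"
    and "B 0 \<noteq> 0"
    and "\<And>n. diff_op Q (B n) = smult (a n) (B n)"
  shows "(finite_order Q \<longrightarrow> poly_interpolated a) \<and>
    (\<not> poly_interpolated a \<longrightarrow> infinite_order Q) \<and>
    (\<not> a constant_on UNIV \<and> has_bounded_subseq a \<longrightarrow> infinite_order Q) \<and>
    (\<not> a constant_on UNIV \<and>
      (((\<forall>n. a n \<ge> 0) \<and> decseq a) \<or> ((\<forall>n. a n \<le> 0) \<and> incseq a)) \<longrightarrow> infinite_order Q) \<and>
    (\<not> a constant_on UNIV \<and> alternating a \<longrightarrow> infinite_order Q)"
proof -
  have interp: "poly_interpolated a" if "\<not> infinite_order Q"
    using poly_interpolated_if_not_infinite_order[of B Q a] assms that by blast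
  moreover have "\<not> infinite_order Q" if fin: "finite_order Q"
  proof -
    obtain n where "\<And>k. k > n \<Longrightarrow> Q k = 0"
      using fin by (auto simp: finite_order_def has_order_def)
    then have "{k. Q k \<noteq> 0} \<subseteq> {..n}"
      by (auto simp: not_less[symmetric])
    then show ?thesis
      by (auto simp: infinite_order_def intro: finite_subset)
  qed
  moreover have bounded: "infinite_order Q" if "\<not> a constant_on UNIV" "has_bounded_subseq a"
    using interp poly_interpolated_bounded_subseq_constant that by blast
  moreover have "infinite_order Q" if "\<not> a constant_on UNIV"
      "((\<forall>n. a n \<ge> 0) \<and> decseq a) \<or> ((\<forall>n. a n \<le> 0) \<and> incseq a)"
    using bounded that monotone_towards_zero_Bseq has_bounded_subseq_if_Bseq by blast
  moreover have "infinite_order Q" if "\<not> a constant_on UNIV" "alternating a"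
    using interp poly_interpolated_alternating_constant that by blast
  ultimately show ?thesis by blast
qed

end
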